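(* Let $\Pi_1=(\mathcal{A},\mathcal{E},\mathcal{R}_1)$ and $\Pi_2=(\mathcal{A},\mathcal{E},\mathcal{R}_2)$ be ELPs. Then: (1) if $\Pi_1$ and $\Pi_2$ are uniformly CWV-equivalent, then they are uniformly WV-equivalent; (2) there exist ELPs $\Pi_1$ and $\Pi_2$ that are uniformly WV-equivalent but not uniformly CWV-equivalent.
   Context: A (ground) logic program is a pair $(\mathcal{A},\mathcal{R})$ with $\mathcal{A}$ a set of propositional atoms and $\mathcal{R}$ a finite set of rules $a_1\vee\cdots\vee a_l\leftarrow a_{l+1},\dots,a_m,\neg\ell_1,\dots,\neg\ell_n$ ($0\le l\le m$, $n\ge 0$, $a_i\in\mathcal{A}$, each $\ell_i$ an atom $a$ or a default-negated atom $\neg a$; a triple negation $\neg\neg\neg a$ is treated as $\neg a$; an empty head is $\bot$). $H(r)=\{a_1,\dots,a_l\}$, $B(r)=\{a_{l+1},\dots,a_m,\neg\ell_1,\dots,\neg\ell_n\}$, $B^+(r)=\{a_{l+1},\dots,a_m\}$. A fact is a rule $a\leftarrow$. An interpretation is $I\subseteq\mathcal{A}$; $I\models a$ iff $a\in I$, $I\models\neg\ell$ iff $I\not\models\ell$; $I\models r$ iff ($I$ satisfies all of $B(r)$ implies $H(r)\cap I\neq\emptyset$); $I$ is a model of a program if it satisfies all its rules. The GL-reduct $\Pi^I$ has rules $\{H(r)\leftarrow B^+(r)\mid r\in\mathcal{R},\ I\models\neg\ell\text{ for all }\neg\ell\in B(r)\}$. $M\subseteq\mathcal{A}$ is an answer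 set of $\Pi$ if $M$ is a model of $\Pi$ and no $M'\subsetneq M$ is a model of $\Pi^M$; $AS(\Pi)$ denotes the set of answer sets. An epistemic literal is $\mathbf{not}\,\ell$ with $\ell$ a literal. An ELP is a triple $\Pi=(\mathcal{A},\mathcal{E},\mathcal{R})$ with $\mathcal{E}$ a set of epistemic literals over $\mathcal{A}$ and $\mathcal{R}$ a finite set of rules $a_1\vee\cdots\vee a_k\leftarrow\ell_1,\dots,\ell_m,\xi_1,\dots,\xi_j,\neg\xi_{j+1},\dots,\neg\xi_n$ with $\ell_i$ literals and $\xi_i\in\mathcal{E}$. Union: $(\mathcal{A}_1,\mathcal{E}_1,\mathcal{R}_1)\cup(\mathcal{A}_2,\mathcal{E}_2,\mathcal{R}_2)=(\mathcal{A}_1\cup\mathcal{A}_2,\mathcal{E}_1\cup\mathcal{E}_2,\mathcal{R}_1\cup\mathcal{R}_2)$; a set of facts $D\subseteq\mathcal{A}$ is the ELP $(\mathcal{A},\emptyset,\{a\leftarrow\mid a\in D\})$. A guess is $\Phi\subseteq\mathcal{E}$. A set $\mathcal{I}$ of interpretations is $\Phi$-compatible w.r.t. $\mathcal{E}$ iff $\mathcal{I}\neq\emptyset$, for each $\mathbf{not}\,\ell\in\Phi$ some $I\in\mathcal{I}$ has $I\not\models\ell$, and for each $\mathbf{not}\,\ell\in\mathcal{E}\setminus\Phi$ all $I\in\mathcal{I}$ satisfy $I\models\ell$. The epistemic reduct $\Pi^\Phi=(\mathcal{A},\mathcal{R}^\Phi)$ is obtained by replacing each occurrence of $\mathbf{not}\,\ell\in\Phi$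 by $\top$ and every remaining $\mathbf{not}$ by $\neg$. $\mathcal{M}$ is a candidate world view (CWV) of $\Pi$ if for some guess $\Phi\subseteq\mathcal{E}$, $\mathcal{M}=AS(\Pi^\Phi)$ and $\mathcal{M}$ is $\Phi$-compatible w.r.t. $\mathcal{E}$. A CWV is a world view (WV) if its guess $\Phi$ is subset-maximal, i.e. no CWV has an associated guess $\Phi'\supsetneq\Phi$. Two ELPs are CWV-equivalent (resp. WV-equivalent) iff their sets of CWVs (resp. WVs) coincide. $\Pi_1,\Pi_2$ are uniformly CWV-equivalent (resp. uniformly WV-equivalent) iff for every set of facts $D\subseteq\mathcal{A}$, $\Pi_1\cup D$ and $\Pi_2\cup D$ are CWV-equivalent (resp. WV-equivalent). *)

theory Defs
  imports Main
begin

datatype 'a literal = Pos 'a | Neg 'a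

fun lit_atom :: "'a literal \<Rightarrow> 'a" where
  "lit_atom (Pos a) = a"
| "lit_atom (Neg a) = a"

fun sat_lit :: "'a set \<Rightarrow> 'a literal \<Rightarrow> bool" where
  "sat_lit I (Pos a) \<longleftrightarrow> a \<in> I"
| "sat_lit I (Neg a) \<longleftrightarrow> a \<notin> I"

text \<open>Body elements of ground rules: an atom \<open>a\<close>, or \<open>\<not>\<ell>\<close> for a literal \<open>\<ell>\<close>
  (so \<open>DNeg (Neg a)\<close> is the double negation \<open>\<not>\<not>a\<close>).\<close>

datatype 'a body_elem = Plain 'a | DNeg "'a literal"

fun sat_elem :: "'a set \<Rightarrow> 'a body_elem \<Rightarrow> bool" where
  "sat_elem I (Plain a) \<longleftrightarrow> a \<in> I"
| "sat_elem I (DNeg l) \<longleftrightarrow> \<not> sat_lit I l"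

datatype 'a rule = Rule (head: "'a set") (body: "'a body_elem set")

definition pos_body :: "'a rule \<Rightarrow> 'a set" where
  "pos_body r = {a. Plain a \<in> body r}"

definition sat_rule :: "'a set \<Rightarrow> 'a rule \<Rightarrow> bool" where
  "sat_rule I r \<longleftrightarrow> ((\<forall>b \<in> body r. sat_elem I b) \<longrightarrow> head r \<inter> I \<noteq> {})"

datatype 'a lp = LP (lp_atoms: "'a set") (lp_rules: "'a rule set")

definition is_model :: "'a set \<Rightarrow> 'a lp \<Rightarrow> bool" where
  "is_model I P \<longleftrightarrow> I \<subseteq> lp_atoms P \<and> (\<forall>r \<in> lp_rules P. sat_rule I r)"

definition gl_reduct :: "'a lp \<Rightarrow> 'a set \<Rightarrow> 'a lp" where
  "gl_reduct P I = LP (lp_atoms P)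
     {Rule (head r) (Plain ` pos_body r) | r.
        r \<in> lp_rules P \<and> (\<forall>l. DNeg l \<in> body r \<longrightarrow> sat_elem I (DNeg l))}"

definition answer_sets :: "'a lp \<Rightarrow> 'a set set" where
  "answer_sets P =
     {M. is_model M P \<and> \<not> (\<exists>M'. M' \<subset> M \<and> is_model M' (gl_reduct P M))}"

text \<open>\<open>ENot \<ell>\<close> is the epistemic literal \<open>not \<ell>\<close>.\<close>

datatype 'a eliteral = ENot "'a literal"

datatype 'a ebody_elem = Lit "'a literal" | Ep "'a eliteral" | NegEp "'a eliteral"

datatype 'a erule = ERule (ehead: "'a set") (ebody: "'a ebody_elem set")

datatype 'a elp = ELP (atoms: "'a set") (eliterals: "'a eliteral set") (erules: "'a erule set")

definition is_erule :: "'a set \<Rightarrow> 'a eliteral set \<Rightarrow> 'a erule \<Rightarrow> bool" where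
  "is_erule A E r \<longleftrightarrow>
     finite (ehead r) \<and> ehead r \<subseteq> A \<and> finite (ebody r) \<and>
     (\<forall>l. Lit l \<in> ebody r \<longrightarrow> lit_atom l \<in> A) \<and>
     (\<forall>x. Ep x \<in> ebody r \<or> NegEp x \<in> ebody r \<longrightarrow> x \<in> E)"

definition is_elp :: "'a elp \<Rightarrow> bool" where
  "is_elp P \<longleftrightarrow>
     (\<forall>l. ENot l \<in> eliterals P \<longrightarrow> lit_atom l \<in> atoms P) \<and>
     finite (erules P) \<and> (\<forall>r \<in> erules P. is_erule (atoms P) (eliterals P) r)"

definition elp_union :: "'a elp \<Rightarrow> 'a elp \<Rightarrow> 'a elp" where
  "elp_union P Q =
     ELP (atoms P \<union> atoms Q) (eliterals P \<union> eliterals Q) (erules P \<union> erules Q)"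

definition facts_elp :: "'a set \<Rightarrow> 'a set \<Rightarrow> 'a elp" where
  "facts_elp A D = ELP A {} {ERule {a} {} | a. a \<in> D}"

definition compatible :: "'a eliteral set \<Rightarrow> 'a eliteral set \<Rightarrow> 'a set set \<Rightarrow> bool" where
  "compatible E \<Phi> \<I> \<longleftrightarrow>
     \<I> \<noteq> {} \<and>
     (\<forall>l. ENot l \<in> \<Phi> \<longrightarrow> (\<exists>I \<in> \<I>. \<not> sat_lit I l)) \<and>
     (\<forall>l. ENot l \<in> E - \<Phi> \<longrightarrow> (\<forall>I \<in> \<I>. sat_lit I l))"

fun lit_elem :: "'a literal \<Rightarrow> 'a body_elem" where
  "lit_elem (Pos a) = Plain a"
| "lit_elem (Neg a) = DNeg (Pos a)"

text \<open>The element \<open>\<not>\<not>\<ell>\<close>, with a triple negation \<open>\<not>\<not>\<not>a\<close> read as \<open>\<not>a\<close>.\<close>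

fun double_neg :: "'a literal \<Rightarrow> 'a body_elem" where
  "double_neg (Pos a) = DNeg (Neg a)"
| "double_neg (Neg a) = DNeg (Pos a)"

text \<open>Replacing \<open>not \<ell> \<in> \<Phi>\<close> by \<open>\<top>\<close> turns a positive occurrence into \<open>\<top>\<close>, which vanishes
  from the body, and a negated occurrence into \<open>\<not>\<top>\<close>; a rule with \<open>\<not>\<top>\<close> in its body is
  vacuous and is left out of the reduct (so the value of \<open>reduct_elem\<close> on such an
  occurrence is never used).\<close>

fun reduct_elem :: "'a eliteral set \<Rightarrow> 'a ebody_elem \<Rightarrow> 'a body_elem set" where
  "reduct_elem \<Phi> (Lit l) = {lit_elem l}"
| "reduct_elem \<Phi> (Ep (ENot l)) = (if ENot l \<in> \<Phi> then {} else {DNeg l})"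
| "reduct_elem \<Phi> (NegEp (ENot l)) = {double_neg l}"

definition epistemic_reduct :: "'a elp \<Rightarrow> 'a eliteral set \<Rightarrow> 'a lp" where
  "epistemic_reduct P \<Phi> = LP (atoms P)
     {Rule (ehead r) (\<Union>b \<in> ebody r. reduct_elem \<Phi> b) | r.
        r \<in> erules P \<and> (\<forall>x. NegEp x \<in> ebody r \<longrightarrow> x \<notin> \<Phi>)}"

definition cwv_with_guess :: "'a elp \<Rightarrow> 'a eliteral set \<Rightarrow> 'a set set \<Rightarrow> bool" where
  "cwv_with_guess P \<Phi> \<M> \<longleftrightarrow>
     \<Phi> \<subseteq> eliterals P \<and> \<M> = answer_sets (epistemic_reduct P \<Phi>) \<and>
     compatible (eliterals P) \<Phi> \<M>"

definition CWVs :: "'a elp \<Rightarrow> 'a set set set" where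
  "CWVs P = {\<M>. \<exists>\<Phi>. cwv_with_guess P \<Phi> \<M>}"

definition WVs :: "'a elp \<Rightarrow> 'a set set set" where
  "WVs P = {\<M>. \<exists>\<Phi>. cwv_with_guess P \<Phi> \<M> \<and>
                 \<not> (\<exists>\<Phi>' \<M>'. cwv_with_guess P \<Phi>' \<M>' \<and> \<Phi> \<subset> \<Phi>')}"

definition CWV_equivalent :: "'a elp \<Rightarrow> 'a elp \<Rightarrow> bool" where
  "CWV_equivalent P Q \<longleftrightarrow> CWVs P = CWVs Q"

definition WV_equivalent :: "'a elp \<Rightarrow> 'a elp \<Rightarrow> bool" where
  "WV_equivalent P Q \<longleftrightarrow> WVs P = WVs Q"

text \<open>The parameter \<open>A\<close> is the common atom set of both programs.\<close>

definition uniformly_CWV_equivalent :: "'a set \<Rightarrow> 'a elp \<Rightarrow> 'a elp \<Rightarrow> bool" where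
  "uniformly_CWV_equivalent A P Q \<longleftrightarrow>
     (\<forall>D. D \<subseteq> A \<longrightarrow>
        CWV_equivalent (elp_union P (facts_elp A D)) (elp_union Q (facts_elp A D)))"

definition uniformly_WV_equivalent :: "'a set \<Rightarrow> 'a elp \<Rightarrow> 'a elp \<Rightarrow> bool" where
  "uniformly_WV_equivalent A P Q \<longleftrightarrow>
     (\<forall>D. D \<subseteq> A \<longrightarrow>
        WV_equivalent (elp_union P (facts_elp A D)) (elp_union Q (facts_elp A D)))"

end

theory Submission imports Defs begin

text \<open>
  Compatibility determines the guess: a candidate world view \<open>\<M>\<close> belongs to exactly the guess
  of those \<open>not \<ell>\<close> whose \<open>\<ell>\<close> fails somewhere in \<open>\<M>\<close>. Hence the world views are a function of
  the candidate world views and the epistemic literals, which gives (1).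

  For (2), with atoms \<open>a = 0\<close> and \<open>b = 1\<close>, take the rules \<open>a \<leftarrow> \<not>b\<close>, \<open>b \<leftarrow> \<not>a\<close> together with \<open>b \<leftarrow> \<not>not a\<close>, \<open>a \<leftarrow> \<not>not b\<close> in the
  first program and with \<open>b \<leftarrow> a, \<not>not a\<close>, \<open>a \<leftarrow> b, \<not>not b\<close> in the second one. Without facts,
  \<open>{{a}, {b}}\<close> is a candidate world view of both, for the full guess. Under the empty guess the
  first program also has \<open>{{a, b}}\<close>, whereas in the second one \<open>a\<close> and \<open>b\<close> support each
  other only circularly. As soon as \<open>a\<close> or \<open>b\<close> is a fact, the two programs agree.
\<close>

section \<open>Guesses determined by candidate world views\<close>

definition induced_guess :: "'a eliteral set \<Rightarrow> 'a set set \<Rightarrow> 'a eliteral set" where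
  "induced_guess E \<M> = {ENot l | l. ENot l \<in> E \<and> (\<exists>I \<in> \<M>. \<not> sat_lit I l)}"

lemma compatible_imp_induced_guess:
  assumes "compatible E \<Phi> \<M>" and "\<Phi> \<subseteq> E"
  shows "\<Phi> = induced_guess E \<M>"
proof (rule set_eqI)
  fix x :: "'a eliteral"
  obtain l where "x = ENot l" by (cases x)
  then show "x \<in> \<Phi> \<longleftrightarrow> x \<in> induced_guess E \<M>"
    using assms unfolding compatible_def induced_guess_def by auto
qed

lemma cwv_with_guess_iff:
  "cwv_with_guess P \<Phi> \<M> \<longleftrightarrow> \<M> \<in> CWVs P \<and> \<Phi> = induced_guess (eliterals P) \<M>"
proof -
  have "\<Psi> = induced_guess (eliterals P) \<M>" if "cwv_with_guess P \<Psi> \<M>" for \<Psi>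
    using that unfolding cwv_with_guess_def by (metis compatible_imp_induced_guess)
  then show ?thesis unfolding CWVs_def by auto
qed

text \<open>By uniqueness of the guess, maximality becomes a comparison of induced guesses. The
  right-hand side depends on \<open>P\<close> only through \<open>CWVs P\<close> and
  \<open>eliterals P\<close>, which is all that (1) needs.\<close>

lemma WVs_eq_maximal_CWVs:
  "WVs P = {\<M> \<in> CWVs P. \<not> (\<exists>\<M>' \<in> CWVs P.
     induced_guess (eliterals P) \<M> \<subset> induced_guess (eliterals P) \<M>')}"
  unfolding WVs_def cwv_with_guess_iff by (rule Collect_cong) metis

lemma CWV_equivalent_imp_WV_equivalent:
  assumes "eliterals P = eliterals Q" and "CWV_equivalent P Q"
  shows "WV_equivalent P Q"
  using assms by (simp add: CWV_equivalent_def WV_equivalent_def WVs_eq_maximal_CWVs)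

section \<open>Answer sets without explicit reducts\<close>

text \<open>\<open>reduct_sat_elem \<Phi> M N\<close> evaluates a body element of the epistemic reduct for \<open>\<Phi>\<close> with
  default negation read in \<open>M\<close> and atoms read in \<open>N\<close>, so that \<open>N\<close> ranges over the models
  of the GL-reduct with respect to \<open>M\<close>.\<close>

fun reduct_sat_elem :: "'a eliteral set \<Rightarrow> 'a set \<Rightarrow> 'a set \<Rightarrow> 'a ebody_elem \<Rightarrow> bool" where
  "reduct_sat_elem \<Phi> M N (Lit (Pos a)) \<longleftrightarrow> a \<in> N"
| "reduct_sat_elem \<Phi> M N (Lit (Neg a)) \<longleftrightarrow> a \<notin> M"
| "reduct_sat_elem \<Phi> M N (Ep (ENot l)) \<longleftrightarrow> ENot l \<in> \<Phi> \<or> \<not> sat_lit M l"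
| "reduct_sat_elem \<Phi> M N (NegEp (ENot l)) \<longleftrightarrow> ENot l \<notin> \<Phi> \<and> sat_lit M l"

definition reduct_sat :: "'a eliteral set \<Rightarrow> 'a set \<Rightarrow> 'a set \<Rightarrow> 'a erule \<Rightarrow> bool" where
  "reduct_sat \<Phi> M N r \<longleftrightarrow>
     (\<forall>b \<in> ebody r. reduct_sat_elem \<Phi> M N b) \<longrightarrow> ehead r \<inter> N \<noteq> {}"

fun gl_sat_elem :: "'a set \<Rightarrow> 'a set \<Rightarrow> 'a body_elem \<Rightarrow> bool" where
  "gl_sat_elem M N (Plain a) \<longleftrightarrow> a \<in> N"
| "gl_sat_elem M N (DNeg l) \<longleftrightarrow> \<not> sat_lit M l"

lemma gl_sat_elem_diag: "gl_sat_elem M M b \<longleftrightarrow> sat_elem M b"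
  by (cases b) auto

lemma gl_sat_body_iff:
  "(\<forall>b \<in> B. gl_sat_elem M N b) \<longleftrightarrow>
     (\<forall>a. Plain a \<in> B \<longrightarrow> a \<in> N) \<and> (\<forall>l. DNeg l \<in> B \<longrightarrow> \<not> sat_lit M l)"
proof -
  have "gl_sat_elem M N b"
    if "b \<in> B" "\<forall>a. Plain a \<in> B \<longrightarrow> a \<in> N" "\<forall>l. DNeg l \<in> B \<longrightarrow> \<not> sat_lit M l" for b
    using that by (cases b) auto
  moreover have "Plain a \<in> B \<Longrightarrow> a \<in> N" "DNeg l \<in> B \<Longrightarrow> \<not> sat_lit M l"
    if "\<forall>b \<in> B. gl_sat_elem M N b" for a l
    using that by force+
  ultimately show ?thesis by blast
qed

text \<open>A rule missing from the GL-reduct has a negated element that is false in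
  \<open>M\<close>, so its body fails under \<open>gl_sat_elem\<close> as well. For a remaining rule
  only the plain atoms are left to be checked in \<open>N\<close>.\<close>

lemma is_model_gl_reduct_iff:
  "is_model N (gl_reduct P M) \<longleftrightarrow> N \<subseteq> lp_atoms P \<and>
     (\<forall>r \<in> lp_rules P. (\<forall>b \<in> body r. gl_sat_elem M N b) \<longrightarrow> head r \<inter> N \<noteq> {})"
proof -
  have "(\<forall>b \<in> body r. gl_sat_elem M N b) \<longleftrightarrow>
      (\<forall>l. DNeg l \<in> body r \<longrightarrow> sat_elem M (DNeg l)) \<and>
      (\<forall>b \<in> Plain ` pos_body r. sat_elem N b)" for r
    unfolding gl_sat_body_iff pos_body_def by auto
  then show ?thesis
    unfolding is_model_def gl_reduct_def sat_rule_def lp.sel setcompr_eq_image ball_simps rule.sel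
    by blast
qed

text \<open>The assumption excludes the case in which \<open>reduct_elem\<close> returns a dummy:
  for \<open>x \<in> \<Phi>\<close> the element \<open>double_neg l\<close> may hold, while
  \<open>reduct_sat_elem\<close> is false.\<close>

lemma reduct_elem_sat_iff:
  assumes "\<And>x. b = NegEp x \<Longrightarrow> x \<notin> \<Phi>"
  shows "(\<forall>c \<in> reduct_elem \<Phi> b. gl_sat_elem M N c) \<longleftrightarrow> reduct_sat_elem \<Phi> M N b"
proof (cases b)
  case (Lit l)
  then show ?thesis by (cases l) auto
next
  case (Ep x)
  then show ?thesis by (cases x) auto
next
  case (NegEp x)
  obtain l where x: "x = ENot l" by (cases x)
  show ?thesis using assms NegEp x by (cases l) auto
qed

lemma reduct_sat_elem_NegEpD: "reduct_sat_elem \<Phi> M N (NegEp x) \<Longrightarrow> x \<notin> \<Phi>"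
  by (cases x) auto

lemma gl_sat_epistemic_reduct_iff:
  "(\<forall>r \<in> lp_rules (epistemic_reduct P \<Phi>).
      (\<forall>b \<in> body r. gl_sat_elem M N b) \<longrightarrow> head r \<inter> N \<noteq> {}) \<longleftrightarrow>
   (\<forall>r \<in> erules P. reduct_sat \<Phi> M N r)"
proof -
  have "(\<forall>x. NegEp x \<in> ebody r \<longrightarrow> x \<notin> \<Phi>) \<and>
      (\<forall>b \<in> (\<Union>b \<in> ebody r. reduct_elem \<Phi> b). gl_sat_elem M N b) \<longleftrightarrow>
      (\<forall>b \<in> ebody r. reduct_sat_elem \<Phi> M N b)" for r
  proof (cases "\<forall>x. NegEp x \<in> ebody r \<longrightarrow> x \<notin> \<Phi>")
    case True
    then have "(\<forall>c \<in> reduct_elem \<Phi> b. gl_sat_elem M N c) \<longleftrightarrow> reduct_sat_elem \<Phi> M N b"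
      if "b \<in> ebody r" for b
      using that by (intro reduct_elem_sat_iff) auto
    with True show ?thesis by auto
  next
    case False
    \<comment> \<open>The rule is left out of the epistemic reduct, and its body is false for
      \<open>reduct_sat_elem\<close>, so both sides are false.\<close>
    then show ?thesis using reduct_sat_elem_NegEpD by blast
  qed
  then have "(\<forall>r \<in> erules P. reduct_sat \<Phi> M N r) \<longleftrightarrow>
      (\<forall>r \<in> erules P. (\<forall>x. NegEp x \<in> ebody r \<longrightarrow> x \<notin> \<Phi>) \<longrightarrow>
        (\<forall>b \<in> (\<Union>b \<in> ebody r. reduct_elem \<Phi> b). gl_sat_elem M N b) \<longrightarrow> ehead r \<inter> N \<noteq> {})"
    unfolding reduct_sat_def by meson
  also have "\<dots> \<longleftrightarrow> (\<forall>r \<in> lp_rules (epistemic_reduct P \<Phi>).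
      (\<forall>b \<in> body r. gl_sat_elem M N b) \<longrightarrow> head r \<inter> N \<noteq> {})"
    unfolding epistemic_reduct_def lp.sel setcompr_eq_image ball_simps rule.sel by auto
  finally show ?thesis by blast
qed

text \<open>Taking \<open>N = M\<close> expresses that \<open>M\<close> is a model of the epistemic
  reduct. The sets \<open>N \<subset> M\<close> are the possible smaller models of its GL-reduct,
  and they inherit \<open>N \<subseteq> atoms P\<close> from \<open>M\<close>.\<close>

lemma answer_sets_epistemic_reduct:
  "M \<in> answer_sets (epistemic_reduct P \<Phi>) \<longleftrightarrow>
     M \<subseteq> atoms P \<and> (\<forall>r \<in> erules P. reduct_sat \<Phi> M M r) \<and>
     (\<forall>N. N \<subset> M \<longrightarrow> \<not> (\<forall>r \<in> erules P. reduct_sat \<Phi> M N r))"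
proof -
  have atoms: "lp_atoms (epistemic_reduct P \<Phi>) = atoms P"
    by (simp add: epistemic_reduct_def)
  have "is_model M (epistemic_reduct P \<Phi>) \<longleftrightarrow>
      M \<subseteq> atoms P \<and> (\<forall>r \<in> erules P. reduct_sat \<Phi> M M r)"
    unfolding is_model_def sat_rule_def atoms
    using gl_sat_epistemic_reduct_iff[of P \<Phi> M M] by (simp add: gl_sat_elem_diag)
  then show ?thesis
    unfolding answer_sets_def is_model_gl_reduct_iff gl_sat_epistemic_reduct_iff atoms by blast
qed

section \<open>Programs extended by facts\<close>

lemma reduct_sat_facts:
  "(\<forall>r \<in> erules (elp_union P (facts_elp A D)). reduct_sat \<Phi> M N r) \<longleftrightarrow>
     D \<subseteq> N \<and> (\<forall>r \<in> erules P. reduct_sat \<Phi> M N r)"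
proof -
  have "reduct_sat \<Phi> M N (ERule {a} {}) \<longleftrightarrow> a \<in> N" for a
    by (simp add: reduct_sat_def)
  then show ?thesis
    unfolding elp_union_def facts_elp_def by (auto simp: ball_Un setcompr_eq_image)
qed

lemma answer_sets_union_facts:
  "M \<in> answer_sets (epistemic_reduct (elp_union P (facts_elp (atoms P) D)) \<Phi>) \<longleftrightarrow>
     M \<subseteq> atoms P \<and> D \<subseteq> M \<and> (\<forall>r \<in> erules P. reduct_sat \<Phi> M M r) \<and>
     (\<forall>N. N \<subset> M \<longrightarrow> \<not> (D \<subseteq> N \<and> (\<forall>r \<in> erules P. reduct_sat \<Phi> M N r)))"
proof -
  have "atoms (elp_union P (facts_elp (atoms P) D)) = atoms P"
    by (simp add: elp_union_def facts_elp_def)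
  then show ?thesis
    unfolding answer_sets_epistemic_reduct reduct_sat_facts by (simp only: conj_assoc)
qed

text \<open>The answer-set test with facts \<open>D\<close> only inspects pairs with
  \<open>D \<subseteq> N \<subseteq> M\<close>, so agreement on these pairs gives the same answer
  sets for every guess.\<close>

lemma CWV_equivalent_union_factsI:
  assumes "\<And>\<Phi> M N. D \<subseteq> N \<Longrightarrow> N \<subseteq> M \<Longrightarrow>
    (\<forall>r \<in> R1. reduct_sat \<Phi> M N r) \<longleftrightarrow> (\<forall>r \<in> R2. reduct_sat \<Phi> M N r)"
  shows "CWV_equivalent (elp_union (ELP A E R1) (facts_elp A D))
                        (elp_union (ELP A E R2) (facts_elp A D))"
proof -
  have "answer_sets (epistemic_reduct (elp_union (ELP A E R1) (facts_elp A D)) \<Phi>) =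
        answer_sets (epistemic_reduct (elp_union (ELP A E R2) (facts_elp A D)) \<Phi>)" for \<Phi>
  proof (rule set_eqI)
    fix M
    have "D \<subseteq> N \<and> (\<forall>r \<in> R1. reduct_sat \<Phi> M N r) \<longleftrightarrow>
        D \<subseteq> N \<and> (\<forall>r \<in> R2. reduct_sat \<Phi> M N r)" if "N \<subseteq> M" for N
      using assms that by blast
    then have "(D \<subseteq> M \<and> (\<forall>r \<in> R1. reduct_sat \<Phi> M M r)) \<and>
        (\<forall>N. N \<subset> M \<longrightarrow> \<not> (D \<subseteq> N \<and> (\<forall>r \<in> R1. reduct_sat \<Phi> M N r))) \<longleftrightarrow>
        (D \<subseteq> M \<and> (\<forall>r \<in> R2. reduct_sat \<Phi> M M r)) \<and>
        (\<forall>N. N \<subset> M \<longrightarrow> \<not> (D \<subseteq> N \<and> (\<forall>r \<in> R2. reduct_sat \<Phi> M N r)))"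
      by (simp only: psubset_eq cong: imp_cong)
    then show "M \<in> answer_sets (epistemic_reduct (elp_union (ELP A E R1) (facts_elp A D)) \<Phi>) \<longleftrightarrow>
          M \<in> answer_sets (epistemic_reduct (elp_union (ELP A E R2) (facts_elp A D)) \<Phi>)"
      using answer_sets_union_facts[of M "ELP A E R1" D \<Phi>]
        answer_sets_union_facts[of M "ELP A E R2" D \<Phi>]
      by (simp only: elp.sel conj_assoc)
  qed
  then show ?thesis
    by (simp add: CWV_equivalent_def CWVs_def cwv_with_guess_def) (simp add: elp_union_def)
qed

section \<open>The separating example for (2)\<close>

definition ex_atoms :: "nat set" where
  "ex_atoms = {0, 1}"

definition ex_eliterals :: "nat eliteral set" where
  "ex_eliterals = {ENot (Pos 0), ENot (Pos 1)}"

definition ex_rules1 :: "nat erule set" where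
  "ex_rules1 = {ERule {0} {Lit (Neg 1)}, ERule {1} {Lit (Neg 0)},
     ERule {1} {NegEp (ENot (Pos 0))}, ERule {0} {NegEp (ENot (Pos 1))}}"

definition ex_rules2 :: "nat erule set" where
  "ex_rules2 = {ERule {0} {Lit (Neg 1)}, ERule {1} {Lit (Neg 0)},
     ERule {1} {Lit (Pos 0), NegEp (ENot (Pos 0))},
     ERule {0} {Lit (Pos 1), NegEp (ENot (Pos 1))}}"

lemma ex_is_elp:
  "is_elp (ELP ex_atoms ex_eliterals ex_rules1)" "is_elp (ELP ex_atoms ex_eliterals ex_rules2)"
  unfolding is_elp_def is_erule_def ex_atoms_def ex_eliterals_def ex_rules1_def ex_rules2_def
  by auto

lemma ex_rules1_sat:
  "(\<forall>r \<in> ex_rules1. reduct_sat \<Phi> M N r) \<longleftrightarrow>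
     (1 \<notin> M \<longrightarrow> 0 \<in> N) \<and> (0 \<notin> M \<longrightarrow> 1 \<in> N) \<and>
     (ENot (Pos 0) \<notin> \<Phi> \<and> 0 \<in> M \<longrightarrow> 1 \<in> N) \<and> (ENot (Pos 1) \<notin> \<Phi> \<and> 1 \<in> M \<longrightarrow> 0 \<in> N)"
  by (auto simp: ex_rules1_def reduct_sat_def)

text \<open>Compared with \<open>ex_rules1_sat\<close>, the last two clauses carry the extra guards
  \<open>0 \<in> N\<close> and \<open>1 \<in> N\<close>, because the added plain atoms are read in
  \<open>N\<close> and not in \<open>M\<close>.\<close>

lemma ex_rules2_sat:
  "(\<forall>r \<in> ex_rules2. reduct_sat \<Phi> M N r) \<longleftrightarrow>
     (1 \<notin> M \<longrightarrow> 0 \<in> N) \<and> (0 \<notin> M \<longrightarrow> 1 \<in> N) \<and>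
     (ENot (Pos 0) \<notin> \<Phi> \<and> 0 \<in> M \<and> 0 \<in> N \<longrightarrow> 1 \<in> N) \<and>
     (ENot (Pos 1) \<notin> \<Phi> \<and> 1 \<in> M \<and> 1 \<in> N \<longrightarrow> 0 \<in> N)"
  by (auto simp: ex_rules2_def reduct_sat_def)

lemma ex_CWV_equivalent_nonempty_facts:
  assumes "D \<subseteq> ex_atoms" and "D \<noteq> {}"
  shows "CWV_equivalent (elp_union (ELP ex_atoms ex_eliterals ex_rules1) (facts_elp ex_atoms D))
                        (elp_union (ELP ex_atoms ex_eliterals ex_rules2) (facts_elp ex_atoms D))"
proof (rule CWV_equivalent_union_factsI)
  fix \<Phi> and M N :: "nat set"
  assume "D \<subseteq> N" "N \<subseteq> M"
  \<comment> \<open>If \<open>0 \<in> N\<close>, the extra guard of the third clause is met and the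
    conclusion of the fourth holds in both programs; the case \<open>1 \<in> N\<close> is
    symmetric.\<close>
  then have "0 \<in> N \<or> 1 \<in> N" using assms by (auto simp: ex_atoms_def)
  then show "(\<forall>r \<in> ex_rules1. reduct_sat \<Phi> M N r) \<longleftrightarrow> (\<forall>r \<in> ex_rules2. reduct_sat \<Phi> M N r)"
    unfolding ex_rules1_sat ex_rules2_sat using \<open>N \<subseteq> M\<close> by blast
qed

lemma subset_doubleton_iff: "X \<subseteq> {x, y} \<longleftrightarrow> X = {} \<or> X = {x} \<or> X = {y} \<or> X = {x, y}"
  unfolding Pow_iff[symmetric] Pow_insert Pow_empty by auto

lemma subset_ex_atoms_cases:
  assumes "M \<subseteq> ex_atoms"
  obtains "M = {}" | "M = {0}" | "M = {1}" | "M = {0, 1}"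
  using assms unfolding ex_atoms_def subset_doubleton_iff by blast

lemma psubset_ex_atoms_iff:
  "N \<subset> {0, 1 :: nat} \<longleftrightarrow> N = {} \<or> N = {0} \<or> N = {1}"
  "N \<subset> {0 :: nat} \<longleftrightarrow> N = {}"
  "N \<subset> {1 :: nat} \<longleftrightarrow> N = {}"
  by auto

text \<open>The set \<open>{0}\<close> survives exactly when \<open>not 0\<close> is guessed, since
  otherwise \<open>1\<close> is derived; likewise for \<open>{1}\<close>. With neither guessed, both
  atoms are forced by \<open>M = {0, 1}\<close>; guessing either one leaves a smaller model of the
  GL-reduct.\<close>

lemma ex_answer_sets1:
  "answer_sets (epistemic_reduct
     (elp_union (ELP ex_atoms ex_eliterals ex_rules1) (facts_elp ex_atoms {})) \<Phi>) =
   (if ENot (Pos 0) \<in> \<Phi> then {{0}} else {}) \<union> (if ENot (Pos 1) \<in> \<Phi> then {{1}} else {}) \<union>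
   (if ENot (Pos 0) \<in> \<Phi> \<or> ENot (Pos 1) \<in> \<Phi> then {} else {{0, 1}})"
  (is "?L = ?R")
proof (rule set_eqI)
  fix M
  have "M \<in> ?L \<longleftrightarrow> M \<subseteq> ex_atoms \<and> (\<forall>r \<in> ex_rules1. reduct_sat \<Phi> M M r) \<and>
      (\<forall>N. N \<subset> M \<longrightarrow> \<not> (\<forall>r \<in> ex_rules1. reduct_sat \<Phi> M N r))"
    using answer_sets_union_facts[of M "ELP ex_atoms ex_eliterals ex_rules1" "{}" \<Phi>] by simp
  also have "\<dots> \<longleftrightarrow> M \<in> ?R"
  proof (cases "M \<subseteq> ex_atoms")
    case True
    then show ?thesis
      unfolding ex_rules1_sat
      by (cases rule: subset_ex_atoms_cases)
        (simp_all add: ex_atoms_def psubset_ex_atoms_iff imp_disjL all_conj_distrib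
          del: One_nat_def)
  qed (auto simp: ex_atoms_def)
  finally show "M \<in> ?L \<longleftrightarrow> M \<in> ?R" .
qed

text \<open>Here \<open>{0, 1}\<close> is never an answer set: for \<open>M = {0, 1}\<close> the
  choice \<open>N = {}\<close> satisfies every clause, whatever the guess.\<close>

lemma ex_answer_sets2:
  "answer_sets (epistemic_reduct
     (elp_union (ELP ex_atoms ex_eliterals ex_rules2) (facts_elp ex_atoms {})) \<Phi>) =
   (if ENot (Pos 0) \<in> \<Phi> then {{0}} else {}) \<union> (if ENot (Pos 1) \<in> \<Phi> then {{1}} else {})"
  (is "?L = ?R")
proof (rule set_eqI)
  fix M
  have "M \<in> ?L \<longleftrightarrow> M \<subseteq> ex_atoms \<and> (\<forall>r \<in> ex_rules2. reduct_sat \<Phi> M M r) \<and>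
      (\<forall>N. N \<subset> M \<longrightarrow> \<not> (\<forall>r \<in> ex_rules2. reduct_sat \<Phi> M N r))"
    using answer_sets_union_facts[of M "ELP ex_atoms ex_eliterals ex_rules2" "{}" \<Phi>] by simp
  also have "\<dots> \<longleftrightarrow> M \<in> ?R"
  proof (cases "M \<subseteq> ex_atoms")
    case True
    then show ?thesis
      unfolding ex_rules2_sat
      by (cases rule: subset_ex_atoms_cases)
        (simp_all add: ex_atoms_def psubset_ex_atoms_iff imp_disjL all_conj_distrib
          del: One_nat_def)
  qed (auto simp: ex_atoms_def)
  finally show "M \<in> ?L \<longleftrightarrow> M \<in> ?R" .
qed

lemma eliterals_union_facts: "eliterals (elp_union (ELP A E R) (facts_elp A D)) = E"
  by (simp add: elp_union_def facts_elp_def)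

lemma subset_ex_eliterals_iff:
  "\<Phi> \<subseteq> ex_eliterals \<longleftrightarrow>
     \<Phi> = {} \<or> \<Phi> = {ENot (Pos 0)} \<or> \<Phi> = {ENot (Pos 1)} \<or> \<Phi> = ex_eliterals"
  unfolding ex_eliterals_def by (rule subset_doubleton_iff)

text \<open>A singleton guess fails: guessing only \<open>not 0\<close> yields \<open>{{0}}\<close>,
  where \<open>0\<close> is never false, and symmetrically for \<open>not 1\<close>. The empty and
  the full guess are compatible.\<close>

lemma ex_CWVs1:
  "CWVs (elp_union (ELP ex_atoms ex_eliterals ex_rules1) (facts_elp ex_atoms {})) =
     {{{0, 1}}, {{0}, {1}}}"
  unfolding CWVs_def cwv_with_guess_def eliterals_union_facts subset_ex_eliterals_iff
    ex_answer_sets1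
  by (simp add: compatible_def ex_eliterals_def conj_disj_distribR ex_disj_distrib Collect_disj_eq
      imp_disjL all_conj_distrib insert_commute del: One_nat_def cong: conj_cong)

text \<open>The empty guess now has no answer sets, and compatibility demands a nonempty set; the
  other guesses behave as in the first program.\<close>

lemma ex_CWVs2:
  "CWVs (elp_union (ELP ex_atoms ex_eliterals ex_rules2) (facts_elp ex_atoms {})) =
     {{{0}, {1}}}"
  unfolding CWVs_def cwv_with_guess_def eliterals_union_facts subset_ex_eliterals_iff
    ex_answer_sets2
  by (simp add: compatible_def ex_eliterals_def conj_disj_distribR ex_disj_distrib Collect_disj_eq
      imp_disjL all_conj_distrib insert_commute del: One_nat_def cong: conj_cong)

text \<open>The extra candidate \<open>{{0, 1}}\<close> has the empty guess, which lies strictly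
  below the full guess of \<open>{{0}, {1}}\<close>, so maximality discards it.\<close>

lemma ex_WV_equivalent_no_facts:
  "WV_equivalent (elp_union (ELP ex_atoms ex_eliterals ex_rules1) (facts_elp ex_atoms {}))
                 (elp_union (ELP ex_atoms ex_eliterals ex_rules2) (facts_elp ex_atoms {}))"
proof -
  have "induced_guess ex_eliterals {{0, 1}} = {}"
    and "induced_guess ex_eliterals {{0}, {1}} = ex_eliterals"
    by (auto simp: induced_guess_def ex_eliterals_def)
  moreover have "ex_eliterals \<noteq> {}"
    by (simp add: ex_eliterals_def)
  ultimately show ?thesis
    unfolding WV_equivalent_def WVs_eq_maximal_CWVs eliterals_union_facts ex_CWVs1 ex_CWVs2
    by auto
qed

theorem proposition1:
  fixes A :: "'a set" and E :: "'a eliteral set" and R1 R2 :: "'a erule set"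
  assumes "is_elp (ELP A E R1)" and "is_elp (ELP A E R2)"
  shows "(uniformly_CWV_equivalent A (ELP A E R1) (ELP A E R2) \<longrightarrow>
            uniformly_WV_equivalent A (ELP A E R1) (ELP A E R2)) \<and>
         (\<exists>(A' :: nat set) E' R1' R2'.
            is_elp (ELP A' E' R1') \<and> is_elp (ELP A' E' R2') \<and>
            uniformly_WV_equivalent A' (ELP A' E' R1') (ELP A' E' R2') \<and>
            \<not> uniformly_CWV_equivalent A' (ELP A' E' R1') (ELP A' E' R2'))"
proof (intro conjI impI exI)
  assume "uniformly_CWV_equivalent A (ELP A E R1) (ELP A E R2)"
  then show "uniformly_WV_equivalent A (ELP A E R1) (ELP A E R2)"
    unfolding uniformly_CWV_equivalent_def uniformly_WV_equivalent_def
    by (metis CWV_equivalent_imp_WV_equivalent eliterals_union_facts)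
next
  show "is_elp (ELP ex_atoms ex_eliterals ex_rules1)"
    and "is_elp (ELP ex_atoms ex_eliterals ex_rules2)"
    by (rule ex_is_elp)+
  show "uniformly_WV_equivalent ex_atoms
      (ELP ex_atoms ex_eliterals ex_rules1) (ELP ex_atoms ex_eliterals ex_rules2)"
    \<comment> \<open>For nonempty \<open>D\<close> the programs are even CWV-equivalent; only
      \<open>D = {}\<close> needs the direct comparison of world views.\<close>
    unfolding uniformly_WV_equivalent_def
    by (metis CWV_equivalent_imp_WV_equivalent eliterals_union_facts
        ex_CWV_equivalent_nonempty_facts ex_WV_equivalent_no_facts)
  have "{{0, 1 :: nat}} \<noteq> {{0}, {1}}"
    by auto
  then have "\<not> CWV_equivalent
      (elp_union (ELP ex_atoms ex_eliterals ex_rules1) (facts_elp ex_atoms {}))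
      (elp_union (ELP ex_atoms ex_eliterals ex_rules2) (facts_elp ex_atoms {}))"
    unfolding CWV_equivalent_def ex_CWVs1 ex_CWVs2 by blast
  then show "\<not> uniformly_CWV_equivalent ex_atoms
      (ELP ex_atoms ex_eliterals ex_rules1) (ELP ex_atoms ex_eliterals ex_rules2)"
    unfolding uniformly_CWV_equivalent_def by blast
qed

end
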